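(* Let $1\to N\xrightarrow{i} G\xrightarrow{\pi} Q\to 1$ be an extension of Hausdorff topological groups (a short exact sequence with $i$ and $\pi$ continuous homomorphisms). Assume that $i$ is a homeomorphism onto its image and that for every compact subset $K\subset Q$ there exists a compact subset $K'\subset G$ with $\pi(K')=K$. Let $n,k$ be non-negative integers. If $\operatorname{asdim}(N)\le n$ and $\operatorname{asdim}(Q)\le k$, then $\operatorname{asdim}(G)\le (n+1)(k+1)-1$.
   Context: Coarse structure: a coarse structure on a set $Y$ is a collection $\mathcal{E}$ of subsets of $Y\times Y$ (entourages) that contains the diagonal and is closed under subsets, finite unions, inverses $E^{-1}=\{(y,x) : (x,y)\in E\}$ and compositions $E_1\circ E_2=\{(x,z) : \exists y,\ (x,y)\in E_1,\ (y,z)\in E_2\}$. Group-compact coarse structure: for a Hausdorff topological group $G$, it is $\mathcal{E}_{\mathcal{C}(G)}=\{E\subset G\times G : E\subset G(K\times K) \text{ for some compact } K\subset G\}$, where $G(K\times K)=\{(ga,gb) : g\in G,\ a,b\in K\}$. Asymptotic dimension: for a coarse space $(Y,\mathcal{E})$ and an integer $n\ge 0$, $\operatorname{asdim}(Y,\mathcal{E})\le n$ means that for every $L\in\mathcal{E}$ there is a cover $\mathcal{U}=\mathcal{U}_0\cup\dots\cup\mathcal{U}_n$ of $Y$ such that each $\mathcal{U}_i$ is $L$-disjoint (for all $A\ne B$ in $\mathcal{U}_i$, $(A\times B)\cap L=\emptyset$) and $\mathcal{U}$ is uniformly bounded (there is $M\in\mathcal{E}$ with $A\times A\subset M$ for all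 $A\in\mathcal{U}$). $\operatorname{asdim}(Y,\mathcal{E})$ is the least such $n$, or $\infty$ if there is none. For a Hausdorff topological group $G$, $\operatorname{asdim}(G):=\operatorname{asdim}(G,\mathcal{E}_{\mathcal{C}(G)})$. *)

theory Defs
  imports "HOL-Analysis.Analysis" "HOL-Algebra.Coset" "HOL-Library.Extended_Nat"
begin

locale topological_group = group G for G (structure) +
  fixes T :: "'a topology"
  assumes topspace_eq_carrier: "topspace T = carrier G"
    and continuous_mult: "continuous_map (prod_topology T T) T (\<lambda>(x, y). x \<otimes> y)"
    and continuous_inv: "continuous_map T T (\<lambda>x. inv x)"

locale Hausdorff_topological_group = topological_group +
  assumes Hausdorff: "Hausdorff_space T"

text \<open>
  Library relation composition \<^term>\<open>E1 O E2\<close> is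
  \<open>{(x, z). \<exists>y. (x, y) \<in> E1 \<and> (y, z) \<in> E2}\<close>, i.e. the left argument is applied first.
\<close>

definition coarse_structure :: "'a set \<Rightarrow> ('a \<times> 'a) set set \<Rightarrow> bool" where
  "coarse_structure Y \<E> \<longleftrightarrow>
     (\<forall>E\<in>\<E>. E \<subseteq> Y \<times> Y) \<and>
     Id_on Y \<in> \<E> \<and>
     (\<forall>E\<in>\<E>. \<forall>F. F \<subseteq> E \<longrightarrow> F \<in> \<E>) \<and>
     (\<forall>E\<in>\<E>. \<forall>F\<in>\<E>. E \<union> F \<in> \<E>) \<and>
     (\<forall>E\<in>\<E>. E\<inverse> \<in> \<E>) \<and>
     (\<forall>E\<in>\<E>. \<forall>F\<in>\<E>. E O F \<in> \<E>)"

definition group_compact_coarse ::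
  "('a, 'm) monoid_scheme \<Rightarrow> 'a topology \<Rightarrow> ('a \<times> 'a) set set" where
  "group_compact_coarse G T =
     {E. \<exists>K. compactin T K \<and>
         E \<subseteq> {(g \<otimes>\<^bsub>G\<^esub> a, g \<otimes>\<^bsub>G\<^esub> b) | g a b. g \<in> carrier G \<and> a \<in> K \<and> b \<in> K}}"

definition entourage_disjoint :: "('a \<times> 'a) set \<Rightarrow> 'a set set \<Rightarrow> bool" where
  "entourage_disjoint L \<U> \<longleftrightarrow> (\<forall>A\<in>\<U>. \<forall>B\<in>\<U>. A \<noteq> B \<longrightarrow> (A \<times> B) \<inter> L = {})"

definition uniformly_bounded :: "('a \<times> 'a) set set \<Rightarrow> 'a set set \<Rightarrow> bool" where
  "uniformly_bounded \<E> \<U> \<longleftrightarrow> (\<exists>M\<in>\<E>. \<forall>A\<in>\<U>. A \<times> A \<subseteq> M)"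

definition asdim_at_most :: "'a set \<Rightarrow> ('a \<times> 'a) set set \<Rightarrow> nat \<Rightarrow> bool" where
  "asdim_at_most Y \<E> n \<longleftrightarrow>
     (\<forall>L\<in>\<E>. \<exists>\<U> :: nat \<Rightarrow> 'a set set.
        \<Union> (\<Union>i\<le>n. \<U> i) = Y \<and>
        (\<forall>i\<le>n. entourage_disjoint L (\<U> i)) \<and>
        uniformly_bounded \<E> (\<Union>i\<le>n. \<U> i))"

text \<open>In \<^typ>\<open>enat\<close> the infimum of a nonempty set is its least element and that of the empty set is \<open>\<infinity>\<close>.\<close>

definition asdim :: "'a set \<Rightarrow> ('a \<times> 'a) set set \<Rightarrow> enat" where
  "asdim Y \<E> = Inf (enat ` {n. asdim_at_most Y \<E> n})"

definition group_asdim :: "('a, 'm) monoid_scheme \<Rightarrow> 'a topology \<Rightarrow> enat" where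
  "group_asdim G T = asdim (carrier G) (group_compact_coarse G T)"

definition topological_group_extension ::
  "('n, 'r) monoid_scheme \<Rightarrow> 'n topology \<Rightarrow> ('n \<Rightarrow> 'g) \<Rightarrow>
   ('g, 's) monoid_scheme \<Rightarrow> 'g topology \<Rightarrow> ('g \<Rightarrow> 'q) \<Rightarrow>
   ('q, 't) monoid_scheme \<Rightarrow> 'q topology \<Rightarrow> bool" where
  "topological_group_extension N TN i G TG \<pi> Q TQ \<longleftrightarrow>
     Hausdorff_topological_group N TN \<and>
     Hausdorff_topological_group G TG \<and>
     Hausdorff_topological_group Q TQ \<and>
     i \<in> mon N G \<and> continuous_map TN TG i \<and>
     \<pi> \<in> epi G Q \<and> continuous_map TG TQ \<pi> \<and>
     i ` carrier N = kernel G Q \<pi>"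

lemma asdim_at_most_mono:
  assumes "asdim_at_most Y \<E> m" "m \<le> n"
  shows "asdim_at_most Y \<E> n"
  unfolding asdim_at_most_def
proof
  fix L assume "L \<in> \<E>"
  then obtain \<U> :: "nat \<Rightarrow> 'a set set" where U: "\<Union> (\<Union>i\<le>m. \<U> i) = Y"
      "\<forall>i\<le>m. entourage_disjoint L (\<U> i)" "uniformly_bounded \<E> (\<Union>i\<le>m. \<U> i)"
    using assms(1) unfolding asdim_at_most_def by blast
  define \<V> where "\<V> i = (if i \<le> m then \<U> i else {})" for i
  have eq: "(\<Union>i\<le>n. \<V> i) = (\<Union>i\<le>m. \<U> i)"
    using assms(2) by (force simp: \<V>_def split: if_splits)
  have "\<forall>i\<le>n. entourage_disjoint L (\<V> i)"
    using U(2) by (simp add: \<V>_def entourage_disjoint_def)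
  with eq U(1,3) show "\<exists>\<U>. \<Union> (\<Union>i\<le>n. \<U> i) = Y \<and>
      (\<forall>i\<le>n. entourage_disjoint L (\<U> i)) \<and> uniformly_bounded \<E> (\<Union>i\<le>n. \<U> i)"
    by (intro exI[of _ \<V>]) simp
qed

lemma asdim_le_iff: "asdim Y \<E> \<le> enat n \<longleftrightarrow> asdim_at_most Y \<E> n"
proof
  assume le: "asdim Y \<E> \<le> enat n"
  let ?S = "enat ` {n. asdim_at_most Y \<E> n}"
  have "?S \<noteq> {}"
  proof
    assume "?S = {}"
    then have "asdim Y \<E> = \<infinity>" unfolding asdim_def Inf_enat_def by simp
    with le show False by simp
  qed
  then have "Inf ?S \<in> ?S"
    unfolding Inf_enat_def by (auto intro: LeastI)
  then obtain m where "asdim_at_most Y \<E> m" "asdim Y \<E> = enat m"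
    by (auto simp: asdim_def)
  with le show "asdim_at_most Y \<E> n"
    using asdim_at_most_mono by simp
qed (auto simp: asdim_def intro: Inf_lower)

lemma (in topological_group) coarse_structure_group_compact:
  "coarse_structure (carrier G) (group_compact_coarse G T)"
proof -
  let ?P = "\<lambda>K. {(g \<otimes> a, g \<otimes> b) | g a b. g \<in> carrier G \<and> a \<in> K \<and> b \<in> K}"
  let ?E = "group_compact_coarse G T"
  have sub: "K \<subseteq> carrier G" if "compactin T K" for K
    using compactin_subset_topspace[OF that] topspace_eq_carrier by simp
  have mult: "compactin T ((\<lambda>(x, y). x \<otimes> y) ` (K \<times> K'))" if "compactin T K" "compactin T K'" for K K'
    using that by (intro image_compactin[OF _ continuous_mult]) (simp add: compactin_Times)
  have minv: "compactin T ((\<lambda>x. inv x) ` K)" if "compactin T K" for K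
    using that by (intro image_compactin[OF _ continuous_inv])
  have I: "E \<in> ?E" if "compactin T K" "E \<subseteq> ?P K" for E K
    using that unfolding group_compact_coarse_def by blast
  have D: "\<exists>K. compactin T K \<and> E \<subseteq> ?P K" if "E \<in> ?E" for E
    using that unfolding group_compact_coarse_def by blast
  have one: "compactin T {\<one>}" by (simp add: topspace_eq_carrier)
  have 1: "E \<subseteq> carrier G \<times> carrier G" if "E \<in> ?E" for E
    using D[OF that] sub by fastforce
  have 2: "Id_on (carrier G) \<in> ?E"
    by (rule I[OF one]) (force simp: Id_on_def)
  have 3: "F \<in> ?E" if "E \<in> ?E" "F \<subseteq> E" for E F
    using D[OF that(1)] I that(2) by (meson subset_trans)
  have 4: "E \<union> F \<in> ?E" if "E \<in> ?E" "F \<in> ?E" for E F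
  proof -
    obtain K K' where K: "compactin T K" "E \<subseteq> ?P K" "compactin T K'" "F \<subseteq> ?P K'"
      using D[OF \<open>E \<in> ?E\<close>] D[OF \<open>F \<in> ?E\<close>] by blast
    show ?thesis
      by (rule I[OF compactin_Un[OF K(1,3)]]) (use K(2,4) in blast)
  qed
  have 5: "E\<inverse> \<in> ?E" if "E \<in> ?E" for E
  proof -
    obtain K where K: "compactin T K" "E \<subseteq> ?P K" using D[OF \<open>E \<in> ?E\<close>] by blast
    show ?thesis by (rule I[OF K(1)]) (use K(2) in blast)
  qed
  have 6: "E O F \<in> ?E" if "E \<in> ?E" "F \<in> ?E" for E F
  proof -
    obtain K K' where K: "compactin T K" "E \<subseteq> ?P K" "compactin T K'" "F \<subseteq> ?P K'"
      using D[OF \<open>E \<in> ?E\<close>] D[OF \<open>F \<in> ?E\<close>] by blast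
    define C where "C = (\<lambda>(x, y). x \<otimes> y) ` (((\<lambda>(x, y). x \<otimes> y) ` (((\<lambda>x. inv x) ` K) \<times> K)) \<times>
       ((\<lambda>(x, y). x \<otimes> y) ` (((\<lambda>x. inv x) ` K') \<times> K')))"
    have C: "compactin T C" unfolding C_def by (intro mult minv K)
    show ?thesis
    proof (rule I[OF compactin_Un[OF one C]], rule subrelI)
      fix x z assume "(x, z) \<in> E O F"
      then obtain y where "(x, y) \<in> E" "(y, z) \<in> F" by blast
      then have "(x, y) \<in> ?P K" "(y, z) \<in> ?P K'" using K(2,4) by (simp_all only: subsetD)
      then obtain g a b h c d where *: "g \<in> carrier G" "a \<in> K" "b \<in> K" "x = g \<otimes> a" "y = g \<otimes> b"
        "h \<in> carrier G" "c \<in> K'" "d \<in> K'" "y = h \<otimes> c" "z = h \<otimes> d"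
        by (elim CollectE exE conjE) (simp only: prod.inject)
      have car: "a \<in> carrier G" "b \<in> carrier G" "c \<in> carrier G" "d \<in> carrier G"
        using * sub K by auto
      let ?w = "(inv a \<otimes> b) \<otimes> (inv c \<otimes> d)"
      have w: "?w \<in> C" unfolding C_def using *(2,3,7,8) by (intro image_eqI[where x = "(inv a \<otimes> b, inv c \<otimes> d)"]) auto
      have cancel: "(u \<otimes> v) \<otimes> (inv v \<otimes> w) = u \<otimes> w"
        if "u \<in> carrier G" "v \<in> carrier G" "w \<in> carrier G" for u v w
        using that by (metis inv_closed inv_solve_left m_assoc m_closed)
      have x: "x \<in> carrier G" using * car by simp
      have "x \<otimes> ?w = (x \<otimes> (inv a \<otimes> b)) \<otimes> (inv c \<otimes> d)"
        using x car by (simp add: m_assoc)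
      also have "x \<otimes> (inv a \<otimes> b) = y" using cancel[OF *(1) car(1,2)] *(4,5) by simp
      also have "y \<otimes> (inv c \<otimes> d) = z" using cancel[OF *(6) car(3,4)] *(9,10) by simp
      finally have "(x, z) = (x \<otimes> \<one>, x \<otimes> ?w)" using x by simp
      moreover have "\<one> \<in> {\<one>} \<union> C" "?w \<in> {\<one>} \<union> C" using w by simp_all
      ultimately show "(x, z) \<in> ?P ({\<one>} \<union> C)" using x by blast
    qed
  qed
  show ?thesis
    unfolding coarse_structure_def
    by (intro conjI ballI allI impI) (fact 1 2 3 4 5 6)+
qed

end

theory Submission
  imports Defs
begin

text \<open>
  Cover \<open>Q\<close> at the scale of \<open>\<pi> ` K\<close> by sets \<open>A\<close> that are bounded by a compact set lifting to
  \<open>B \<subseteq> G\<close>. Each preimage of \<open>A\<close> lies in \<open>g \<cdot> i(N) \<cdot> B\<close> for some \<open>g\<close>, so it is coarsely a copy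
  of \<open>N\<close>: write \<open>x = g \<cdot> i(\<nu> x) \<cdot> b\<close> and pull back along \<open>\<nu>\<close> a cover of \<open>N\<close> at the scale
  of \<open>i\<^sup>-\<^sup>1(B K B\<^sup>-\<^sup>1)\<close>, which is compact because \<open>i\<close> is a closed embedding. The pulled back
  sets are indexed by pairs of colours, of which there are \<open>(k + 1) (n + 1)\<close>.
\<close>

section \<open>Entourages and covers of a group in terms of differences
  \<open>inv x \<otimes> y\<close>\<close>

context topological_group
begin

lemma inv_mult_cancel_left: "x \<in> carrier G \<Longrightarrow> y \<in> carrier G \<Longrightarrow> inv x \<otimes> (x \<otimes> y) = y"
  by (simp flip: m_assoc)

lemma mult_inv_cancel_left: "x \<in> carrier G \<Longrightarrow> y \<in> carrier G \<Longrightarrow> x \<otimes> (inv x \<otimes> y) = y"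
  by (simp flip: m_assoc)

lemma compactin_subset_carrier: "compactin T K \<Longrightarrow> K \<subseteq> carrier G"
  using compactin_subset_topspace topspace_eq_carrier by metis

lemma compactin_set_mult:
  assumes "compactin T K" "compactin T K'"
  shows "compactin T (K <#> K')"
proof -
  have "compactin T ((\<lambda>(x, y). x \<otimes> y) ` (K \<times> K'))"
    using assms by (intro image_compactin[OF _ continuous_mult]) (simp add: compactin_Times)
  moreover have "(\<lambda>(x, y). x \<otimes> y) ` (K \<times> K') = K <#> K'"
    by (auto simp: set_mult_def)
  ultimately show ?thesis by simp
qed

lemma compactin_set_inv:
  assumes "compactin T K"
  shows "compactin T (m_inv G ` K)"
  using image_compactin[OF assms continuous_inv] by simp

text \<open>Left translation leaves \<open>inv x \<otimes> y\<close> unchanged, so pairs (ga, gb)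
  with a, b in \<open>K\<close> have differences in the compact set K^-1 K. Conversely, a pair is
  recovered from its difference by translating with \<open>g = x\<close>.\<close>

lemma group_compact_coarse_iff:
  "E \<in> group_compact_coarse G T \<longleftrightarrow>
     E \<subseteq> carrier G \<times> carrier G \<and>
     (\<exists>K. compactin T K \<and> (\<forall>(x, y)\<in>E. inv x \<otimes> y \<in> K))"
proof
  assume E: "E \<in> group_compact_coarse G T"
  then obtain K where K: "compactin T K"
    "E \<subseteq> {(g \<otimes> a, g \<otimes> b) | g a b. g \<in> carrier G \<and> a \<in> K \<and> b \<in> K}"
    unfolding group_compact_coarse_def by blast
  have "inv x \<otimes> y \<in> m_inv G ` K <#> K" if "(x, y) \<in> E" for x y
  proof -
    obtain g a b where g: "x = g \<otimes> a" "y = g \<otimes> b" "g \<in> carrier G" "a \<in> K" "b \<in> K"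
      using K(2) \<open>(x, y) \<in> E\<close> by blast
    then have "a \<in> carrier G" "b \<in> carrier G"
      using compactin_subset_carrier[OF K(1)] by auto
    then have "inv x \<otimes> y = inv a \<otimes> b"
      using g by (simp add: inv_mult_group m_assoc inv_mult_cancel_left)
    then show ?thesis
      using g by (auto simp: set_mult_def)
  qed
  moreover have "E \<subseteq> carrier G \<times> carrier G"
    using coarse_structure_group_compact E unfolding coarse_structure_def by blast
  ultimately show "E \<subseteq> carrier G \<times> carrier G \<and>
      (\<exists>K. compactin T K \<and> (\<forall>(x, y)\<in>E. inv x \<otimes> y \<in> K))"
    using compactin_set_mult[OF compactin_set_inv[OF K(1)] K(1)] by blast
next
  assume "E \<subseteq> carrier G \<times> carrier G \<and>
      (\<exists>K. compactin T K \<and> (\<forall>(x, y)\<in>E. inv x \<otimes> y \<in> K))"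
  then obtain K where K: "E \<subseteq> carrier G \<times> carrier G" "compactin T K"
    "\<And>x y. (x, y) \<in> E \<Longrightarrow> inv x \<otimes> y \<in> K"
    by blast
  \<comment> \<open>The unit is adjoined so that \<open>x\<close> itself has the form
    \<open>x \<otimes> \<one>\<close> with second factor in the compact set.\<close>
  have "compactin T ({\<one>} \<union> K)"
    using K(2) by (intro compactin_Un) (auto simp: topspace_eq_carrier)
  moreover
  have "(x, y) \<in> {(g \<otimes> a, g \<otimes> b) | g a b.
      g \<in> carrier G \<and> a \<in> {\<one>} \<union> K \<and> b \<in> {\<one>} \<union> K}" if "(x, y) \<in> E" for x y
  proof -
    have "x \<in> carrier G" "y \<in> carrier G" using K(1) that by auto
    then have "x = x \<otimes> \<one>" "y = x \<otimes> (inv x \<otimes> y)"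
      by (simp_all add: mult_inv_cancel_left)
    with \<open>x \<in> carrier G\<close> K(3)[OF that] show ?thesis by blast
  qed
  then have "E \<subseteq> {(g \<otimes> a, g \<otimes> b) | g a b.
      g \<in> carrier G \<and> a \<in> {\<one>} \<union> K \<and> b \<in> {\<one>} \<union> K}"
    by (rule subrelI)
  ultimately show "E \<in> group_compact_coarse G T"
    unfolding group_compact_coarse_def by blast
qed

text \<open>Turns entourages into compact sets of differences: the cover is taken for the largest
  entourage with differences in \<open>K\<close>. Disjointness is put in contrapositive form, so
  that close points force their sets to coincide.\<close>

lemma asdim_at_most_groupE:
  assumes "asdim_at_most (carrier G) (group_compact_coarse G T) n" "compactin T K"
  obtains \<U> M where "compactin T M" "\<Union> (\<Union>j\<le>n. \<U> j) = carrier G"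
    "\<And>j A B x y. j \<le> n \<Longrightarrow> A \<in> \<U> j \<Longrightarrow> B \<in> \<U> j \<Longrightarrow> x \<in> A \<Longrightarrow> y \<in> B \<Longrightarrow>
       inv x \<otimes> y \<in> K \<Longrightarrow> A = B"
    "\<And>j A x y. j \<le> n \<Longrightarrow> A \<in> \<U> j \<Longrightarrow> x \<in> A \<Longrightarrow> y \<in> A \<Longrightarrow> inv x \<otimes> y \<in> M"
proof -
  let ?L = "{(x, y). x \<in> carrier G \<and> y \<in> carrier G \<and> inv x \<otimes> y \<in> K}"
  have L: "?L \<in> group_compact_coarse G T"
    using assms(2) unfolding group_compact_coarse_iff by auto
  obtain \<U> where U: "\<Union> (\<Union>j\<le>n. \<U> j) = carrier G"
    "\<forall>j\<le>n. entourage_disjoint ?L (\<U> j)"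
    and "uniformly_bounded (group_compact_coarse G T) (\<Union>j\<le>n. \<U> j)"
    using bspec[OF assms(1)[unfolded asdim_at_most_def] L] by (elim exE conjE)
  then obtain E where E: "E \<in> group_compact_coarse G T" "\<forall>A\<in>(\<Union>j\<le>n. \<U> j). A \<times> A \<subseteq> E"
    unfolding uniformly_bounded_def by (elim bexE)
  obtain M where M: "compactin T M" "\<And>x y. (x, y) \<in> E \<Longrightarrow> inv x \<otimes> y \<in> M"
    using E(1) unfolding group_compact_coarse_iff by blast
  have sub: "A \<subseteq> carrier G" if "j \<le> n" "A \<in> \<U> j" for j A
    using U(1) that by blast
  have "A = B" if "j \<le> n" "A \<in> \<U> j" "B \<in> \<U> j" "x \<in> A" "y \<in> B" "inv x \<otimes> y \<in> K" for j A B x y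
  proof -
    have "(x, y) \<in> (A \<times> B) \<inter> ?L"
      using that sub by blast
    then show ?thesis
      using U(2) that(1-3) unfolding entourage_disjoint_def by blast
  qed
  moreover have "inv x \<otimes> y \<in> M" if "j \<le> n" "A \<in> \<U> j" "x \<in> A" "y \<in> A" for j A x y
    using E(2) M(2) that by blast
  ultimately show thesis
    by (rule that[OF M(1) U(1)])
qed

text \<open>Converse passage: every entourage has its differences in some compact \<open>K\<close>,
  so covers separated at each compact scale suffice. The bounding entourage consists of all pairs
  with difference in \<open>M\<close>.\<close>

lemma asdim_at_most_groupI:
  assumes "\<And>K. compactin T K \<Longrightarrow> \<exists>\<U> M. compactin T M \<and>
      \<Union> (\<Union>j\<le>n. \<U> j) = carrier G \<and>
      (\<forall>j\<le>n. \<forall>A\<in>\<U> j. \<forall>B\<in>\<U> j. \<forall>x\<in>A. \<forall>y\<in>B. inv x \<otimes> y \<in> K \<longrightarrow> A = B) \<and>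
      (\<forall>j\<le>n. \<forall>A\<in>\<U> j. \<forall>x\<in>A. \<forall>y\<in>A. inv x \<otimes> y \<in> M)"
  shows "asdim_at_most (carrier G) (group_compact_coarse G T) n"
  unfolding asdim_at_most_def
proof
  fix L assume "L \<in> group_compact_coarse G T"
  then obtain K where K: "compactin T K" "\<And>x y. (x, y) \<in> L \<Longrightarrow> inv x \<otimes> y \<in> K"
    unfolding group_compact_coarse_iff by blast
  obtain \<U> M where M: "compactin T M" and U: "\<Union> (\<Union>j\<le>n. \<U> j) = carrier G"
    and disj: "\<forall>j\<le>n. \<forall>A\<in>\<U> j. \<forall>B\<in>\<U> j. \<forall>x\<in>A. \<forall>y\<in>B. inv x \<otimes> y \<in> K \<longrightarrow> A = B"
    and bdd: "\<forall>j\<le>n. \<forall>A\<in>\<U> j. \<forall>x\<in>A. \<forall>y\<in>A. inv x \<otimes> y \<in> M"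
    using assms[OF K(1)] by (elim exE conjE)
  let ?M = "{(x, y). x \<in> carrier G \<and> y \<in> carrier G \<and> inv x \<otimes> y \<in> M}"
  have "?M \<in> group_compact_coarse G T"
    using M unfolding group_compact_coarse_iff by auto
  moreover have "A \<times> A \<subseteq> ?M" if "A \<in> (\<Union>j\<le>n. \<U> j)" for A
  proof -
    have "A \<subseteq> carrier G" using U that by blast
    then show ?thesis using bdd that by blast
  qed
  ultimately have "uniformly_bounded (group_compact_coarse G T) (\<Union>j\<le>n. \<U> j)"
    unfolding uniformly_bounded_def by (intro bexI[of _ ?M]) blast+
  moreover have "entourage_disjoint L (\<U> j)" if "j \<le> n" for j
    unfolding entourage_disjoint_def using disj that K(2) by blast
  ultimately show "\<exists>\<U>. \<Union> (\<Union>j\<le>n. \<U> j) = carrier G \<and>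
      (\<forall>j\<le>n. entourage_disjoint L (\<U> j)) \<and>
      uniformly_bounded (group_compact_coarse G T) (\<Union>j\<le>n. \<U> j)"
    using U by blast
qed

end

text \<open>A closed image meets \<open>K\<close> in a compact set, and the homeomorphism onto the
  image carries that set back to \<open>X\<close>.\<close>

lemma compactin_closed_embedding_preimage:
  assumes i: "embedding_map X Y i" "closedin Y (i ` topspace X)" and K: "compactin Y K"
  shows "compactin X {x \<in> topspace X. i x \<in> K}"
proof -
  have "compactin Y (i ` topspace X \<inter> K)"
    using i(2) K by (rule closed_Int_compactin)
  moreover have "i ` {x \<in> topspace X. i x \<in> K} = i ` topspace X \<inter> K"
    by blast
  ultimately have "compactin (subtopology Y (i ` topspace X)) (i ` {x \<in> topspace X. i x \<in> K})"
    by (simp add: compactin_subtopology)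
  moreover have "{x \<in> topspace X. i x \<in> K} \<subseteq> topspace X"
    by blast
  ultimately show ?thesis
    using homeomorphic_map_compactness[OF i(1)[unfolded embedding_map_def]] by simp
qed

theorem theorem3p16:
  fixes N :: "('n, 'r) monoid_scheme" and TN :: "'n topology"
    and G :: "('g, 's) monoid_scheme" and TG :: "'g topology"
    and Q :: "('q, 't) monoid_scheme" and TQ :: "'q topology"
    and i :: "'n \<Rightarrow> 'g" and \<pi> :: "'g \<Rightarrow> 'q"
    and n k :: nat
  assumes "topological_group_extension N TN i G TG \<pi> Q TQ"
    and "embedding_map TN TG i"
    and "\<And>K. compactin TQ K \<Longrightarrow> \<exists>K'. compactin TG K' \<and> \<pi> ` K' = K"
    and "group_asdim N TN \<le> enat n"
    and "group_asdim Q TQ \<le> enat k"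
  shows "group_asdim G TG \<le> enat ((n + 1) * (k + 1) - 1)"
proof -
  interpret N: Hausdorff_topological_group N TN
    using assms(1) unfolding topological_group_extension_def by blast
  interpret G: Hausdorff_topological_group G TG
    using assms(1) unfolding topological_group_extension_def by blast
  interpret Q: Hausdorff_topological_group Q TQ
    using assms(1) unfolding topological_group_extension_def by blast
  have i: "i \<in> hom N G" and cont_i: "continuous_map TN TG i"
    and \<pi>: "\<pi> \<in> hom G Q" and surj: "\<pi> ` carrier G = carrier Q"
    and cont_\<pi>: "continuous_map TG TQ \<pi>"
    and exact: "i ` carrier N = kernel G Q \<pi>"
    using assms(1) unfolding topological_group_extension_def mon_def epi_def by auto
  interpret i: group_hom N G i
    using i by unfold_locales
  interpret \<pi>: group_hom G Q \<pi>
    using \<pi> by unfold_locales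
  \<comment> \<open>Points of the Hausdorff group \<open>Q\<close> are closed, hence so is the
    kernel of \<open>\<pi>\<close>, which is the image of \<open>i\<close>.\<close>
  have "closedin TG {x \<in> topspace TG. \<pi> x \<in> {\<one>\<^bsub>Q\<^esub>}}"
    by (intro closedin_continuous_map_preimage[OF cont_\<pi>] closedin_Hausdorff_singleton Q.Hausdorff)
      (simp add: Q.topspace_eq_carrier)
  then have closed: "closedin TG (i ` topspace TN)"
    by (simp add: N.topspace_eq_carrier G.topspace_eq_carrier exact kernel_def)

  have "asdim_at_most (carrier G) (group_compact_coarse G TG) ((n + 1) * (k + 1) - 1)"
  proof (rule G.asdim_at_most_groupI)

    \<comment> \<open>Choice of scales and of the covers of \<open>Q\<close> and
      \<open>N\<close>\<close>
    fix K assume K: "compactin TG K"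
    have "compactin TQ (\<pi> ` K)"
      using K cont_\<pi> by (rule image_compactin)
    then obtain \<U> M where M: "compactin TQ M" and U: "\<Union> (\<Union>j\<le>k. \<U> j) = carrier Q"
      and U_disj: "\<And>j A A' x y. j \<le> k \<Longrightarrow> A \<in> \<U> j \<Longrightarrow> A' \<in> \<U> j \<Longrightarrow> x \<in> A \<Longrightarrow> y \<in> A' \<Longrightarrow>
         inv\<^bsub>Q\<^esub> x \<otimes>\<^bsub>Q\<^esub> y \<in> \<pi> ` K \<Longrightarrow> A = A'"
      and U_bdd: "\<And>j A x y. j \<le> k \<Longrightarrow> A \<in> \<U> j \<Longrightarrow> x \<in> A \<Longrightarrow> y \<in> A \<Longrightarrow>
         inv\<^bsub>Q\<^esub> x \<otimes>\<^bsub>Q\<^esub> y \<in> M"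
      by (rule Q.asdim_at_most_groupE[OF assms(5)[unfolded group_asdim_def asdim_le_iff]]) blast
    obtain B where B: "compactin TG B" "\<pi> ` B = M"
      using assms(3)[OF M] by blast
    have B_carrier: "B \<subseteq> carrier G"
      using B(1) by (rule G.compactin_subset_carrier)
    \<comment> \<open>By \<open>diff\<close> below, points of \<open>G\<close> over the same
      \<open>A\<close> with difference in \<open>K\<close> have \<open>N\<close>-coordinates whose
      difference maps into B K B^-1. This set does not depend on \<open>A\<close>, so a single cover
      of \<open>N\<close> serves all preimages.\<close>
    define L where "L = {h \<in> topspace TN. i h \<in> B <#>\<^bsub>G\<^esub> K <#>\<^bsub>G\<^esub> m_inv G ` B}"
    have "compactin TG (B <#>\<^bsub>G\<^esub> K <#>\<^bsub>G\<^esub> m_inv G ` B)"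
      by (intro G.compactin_set_mult G.compactin_set_inv B(1) K)
    then have "compactin TN L"
      unfolding L_def by (rule compactin_closed_embedding_preimage[OF assms(2) closed])
    then obtain \<V> C where C: "compactin TN C" and V: "\<Union> (\<Union>j\<le>n. \<V> j) = carrier N"
      and V_disj: "\<And>j A A' x y. j \<le> n \<Longrightarrow> A \<in> \<V> j \<Longrightarrow> A' \<in> \<V> j \<Longrightarrow> x \<in> A \<Longrightarrow> y \<in> A' \<Longrightarrow>
         inv\<^bsub>N\<^esub> x \<otimes>\<^bsub>N\<^esub> y \<in> L \<Longrightarrow> A = A'"
      and V_bdd: "\<And>j A x y. j \<le> n \<Longrightarrow> A \<in> \<V> j \<Longrightarrow> x \<in> A \<Longrightarrow> y \<in> A \<Longrightarrow>
         inv\<^bsub>N\<^esub> x \<otimes>\<^bsub>N\<^esub> y \<in> C"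
      by (rule N.asdim_at_most_groupE[OF assms(4)[unfolded group_asdim_def asdim_le_iff]]) blast

    \<comment> \<open>Coordinates in \<open>N\<close> on the preimage of each set
      \<open>A\<close>\<close>
    have "\<exists>g \<nu> \<beta>. \<forall>x\<in>carrier G. \<pi> x \<in> A \<longrightarrow>
        g \<in> carrier G \<and> \<nu> x \<in> carrier N \<and> \<beta> x \<in> B \<and> x = g \<otimes>\<^bsub>G\<^esub> (i (\<nu> x) \<otimes>\<^bsub>G\<^esub> \<beta> x)"
      if A: "A \<in> (\<Union>j\<le>k. \<U> j)" for A
    \<comment> \<open>A nonempty \<open>A\<close> supplies the base point that \<open>g\<close>
      lifts; for empty \<open>A\<close> the claim is vacuous.\<close>
    proof (cases "A = {}")
      case False
      then obtain q where q: "q \<in> A" by blast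
      then have "q \<in> carrier Q" using U A by blast
      then obtain g where g: "g \<in> carrier G" "\<pi> g = q" using surj by (metis imageE)
      have "\<exists>h b. h \<in> carrier N \<and> b \<in> B \<and> x = g \<otimes>\<^bsub>G\<^esub> (i h \<otimes>\<^bsub>G\<^esub> b)"
        if x: "x \<in> carrier G" "\<pi> x \<in> A" for x
      proof -
        have "inv\<^bsub>Q\<^esub> (\<pi> g) \<otimes>\<^bsub>Q\<^esub> \<pi> x \<in> M"
          using U_bdd A q x(2) g(2) by blast
        then obtain b where b: "b \<in> B" "\<pi> b = inv\<^bsub>Q\<^esub> (\<pi> g) \<otimes>\<^bsub>Q\<^esub> \<pi> x"
          using B(2) by (metis imageE)
        have bG: "b \<in> carrier G" using b B_carrier by blast
        \<comment> \<open>Since \<open>\<pi> b\<close> equals the difference of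
          \<open>\<pi> g\<close> and \<open>\<pi> x\<close>, this element maps to the unit of
          \<open>Q\<close>; exactness then gives its preimage \<open>h\<close> in
          \<open>N\<close>.\<close>
        let ?z = "inv\<^bsub>G\<^esub> g \<otimes>\<^bsub>G\<^esub> x \<otimes>\<^bsub>G\<^esub> inv\<^bsub>G\<^esub> b"
        have "\<pi> ?z = \<pi> b \<otimes>\<^bsub>Q\<^esub> inv\<^bsub>Q\<^esub> \<pi> b"
          using bG x g b(2) by simp
        then have "?z \<in> kernel G Q \<pi>"
          using bG x g by (simp add: kernel_def)
        then obtain h where h: "h \<in> carrier N" "i h = ?z"
          using exact by (metis imageE)
        have "g \<otimes>\<^bsub>G\<^esub> (?z \<otimes>\<^bsub>G\<^esub> b) = x"
          using g x bG by (simp add: G.m_assoc G.mult_inv_cancel_left)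
        then show ?thesis using h b(1) by metis
      qed
      then obtain \<nu> \<beta> where "\<And>x. x \<in> carrier G \<Longrightarrow> \<pi> x \<in> A \<Longrightarrow>
          \<nu> x \<in> carrier N \<and> \<beta> x \<in> B \<and> x = g \<otimes>\<^bsub>G\<^esub> (i (\<nu> x) \<otimes>\<^bsub>G\<^esub> \<beta> x)"
        by metis
      then show ?thesis using g(1) by blast
    qed auto
    then obtain g \<nu> \<beta> where dec: "\<And>A x. A \<in> (\<Union>j\<le>k. \<U> j) \<Longrightarrow> x \<in> carrier G \<Longrightarrow> \<pi> x \<in> A \<Longrightarrow>
        g A \<in> carrier G \<and> \<nu> A x \<in> carrier N \<and> \<beta> A x \<in> B \<and>
        x = g A \<otimes>\<^bsub>G\<^esub> (i (\<nu> A x) \<otimes>\<^bsub>G\<^esub> \<beta> A x)"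
      by metis
    \<comment> \<open>The translation \<open>g A\<close> cancels, so the bounds obtained from this
      formula are uniform in \<open>A\<close>.\<close>
    have diff: "inv\<^bsub>G\<^esub> x \<otimes>\<^bsub>G\<^esub> y =
        inv\<^bsub>G\<^esub> (\<beta> A x) \<otimes>\<^bsub>G\<^esub> i (inv\<^bsub>N\<^esub> (\<nu> A x) \<otimes>\<^bsub>N\<^esub> \<nu> A y) \<otimes>\<^bsub>G\<^esub> \<beta> A y"
      if A: "A \<in> (\<Union>j\<le>k. \<U> j)" and x: "x \<in> carrier G" "\<pi> x \<in> A" and y: "y \<in> carrier G" "\<pi> y \<in> A"
      for A x y
    proof -
      \<comment> \<open>The identity is proved for free elements because the decomposition of
        \<open>x\<close> contains \<open>x\<close> again, inside \<open>\<nu> A x\<close> and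
        \<open>\<beta> A x\<close>.\<close>
      have *: "inv\<^bsub>G\<^esub> (a \<otimes>\<^bsub>G\<^esub> (i h \<otimes>\<^bsub>G\<^esub> b)) \<otimes>\<^bsub>G\<^esub> (a \<otimes>\<^bsub>G\<^esub> (i h' \<otimes>\<^bsub>G\<^esub> b')) =
          inv\<^bsub>G\<^esub> b \<otimes>\<^bsub>G\<^esub> i (inv\<^bsub>N\<^esub> h \<otimes>\<^bsub>N\<^esub> h') \<otimes>\<^bsub>G\<^esub> b'"
        if "a \<in> carrier G" "h \<in> carrier N" "h' \<in> carrier N" "b \<in> B" "b' \<in> B" for a h h' b b'
      proof -
        have "b \<in> carrier G" "b' \<in> carrier G" using that B_carrier by auto
        with that show ?thesis
          by (simp add: G.inv_mult_group G.m_assoc G.inv_mult_cancel_left)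
      qed
      show ?thesis
        using *[of "g A" "\<nu> A x" "\<nu> A y" "\<beta> A x" "\<beta> A y"] dec[OF A x] dec[OF A y] by metis
    qed
    have V_eq: "V = V'"
      if A: "A \<in> (\<Union>j\<le>k. \<U> j)" and x: "x \<in> carrier G" "\<pi> x \<in> A" and y: "y \<in> carrier G" "\<pi> y \<in> A"
        and xy: "inv\<^bsub>G\<^esub> x \<otimes>\<^bsub>G\<^esub> y \<in> K"
        and V: "l \<le> n" "V \<in> \<V> l" "V' \<in> \<V> l" "\<nu> A x \<in> V" "\<nu> A y \<in> V'" for A x y l V V'
    proof -
      let ?h = "inv\<^bsub>N\<^esub> (\<nu> A x) \<otimes>\<^bsub>N\<^esub> \<nu> A y"
      have \<nu>: "\<nu> A x \<in> carrier N" "\<nu> A y \<in> carrier N" and \<beta>: "\<beta> A x \<in> B" "\<beta> A y \<in> B"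
        using dec[OF A x] dec[OF A y] by auto
      have \<beta>G: "\<beta> A x \<in> carrier G" "\<beta> A y \<in> carrier G" and h: "?h \<in> carrier N" "i ?h \<in> carrier G"
        using \<nu> \<beta> B_carrier by auto
      \<comment> \<open>This is \<open>diff\<close> solved for its middle factor.\<close>
      have "i ?h = \<beta> A x \<otimes>\<^bsub>G\<^esub> (inv\<^bsub>G\<^esub> x \<otimes>\<^bsub>G\<^esub> y) \<otimes>\<^bsub>G\<^esub> inv\<^bsub>G\<^esub> (\<beta> A y)"
        unfolding diff[OF A x y] using \<beta>G h(2) by (simp add: G.m_assoc G.mult_inv_cancel_left del: i.hom_mult)
      then have "i ?h \<in> B <#>\<^bsub>G\<^esub> K <#>\<^bsub>G\<^esub> m_inv G ` B"
        using \<beta> xy unfolding set_mult_def by blast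
      then have "?h \<in> L"
        unfolding L_def using h(1) by (simp add: N.topspace_eq_carrier)
      then show ?thesis using V_disj V by blast
    qed

    \<comment> \<open>The combined cover of \<open>G\<close>\<close>
    define W where "W A V = {x \<in> carrier G. \<pi> x \<in> A \<and> \<nu> A x \<in> V}" for A V
    \<comment> \<open>The colour \<open>m\<close> encodes a pair: the quotient by
      \<open>n + 1\<close> is a colour of the cover of \<open>Q\<close>, the remainder one of the
      cover of \<open>N\<close>. The values \<open>0\<close> to \<open>(n + 1) * (k + 1) - 1\<close>
      run through each pair once.\<close>
    define \<W> where "\<W> m = {W A V | A V. A \<in> \<U> (m div (n + 1)) \<and> V \<in> \<V> (m mod (n + 1))}" for m
    \<comment> \<open>The bound is read off from \<open>diff\<close>: the outer factors lie in B^-1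
      and \<open>B\<close>, and the \<open>N\<close>-differences within one \<open>V\<close> lie in
      \<open>C\<close>.\<close>
    define D where "D = m_inv G ` B <#>\<^bsub>G\<^esub> i ` C <#>\<^bsub>G\<^esub> B"
    let ?d = "(n + 1) * (k + 1) - 1"
    have div: "m div (n + 1) \<le> k" if "m \<le> ?d" for m
    proof -
      have "m < (k + 1) * (n + 1)" using that by (simp add: mult.commute)
      then have "m div (n + 1) < k + 1" by (simp only: less_mult_imp_div_less)
      then show ?thesis by simp
    qed
    have mod: "m mod (n + 1) \<le> n" for m
      using mod_less_divisor[of "n + 1" m] by linarith
    have "compactin TG D"
      unfolding D_def
      by (intro G.compactin_set_mult G.compactin_set_inv B(1) image_compactin[OF C cont_i])
    moreover have "\<Union> (\<Union>m\<le>?d. \<W> m) = carrier G"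
    proof
      show "\<Union> (\<Union>m\<le>?d. \<W> m) \<subseteq> carrier G"
        by (auto simp: \<W>_def W_def)
      show "carrier G \<subseteq> \<Union> (\<Union>m\<le>?d. \<W> m)"
      proof
        fix x assume x: "x \<in> carrier G"
        then have "\<pi> x \<in> \<Union> (\<Union>j\<le>k. \<U> j)"
          by (simp add: U)
        then obtain j A where A: "j \<le> k" "A \<in> \<U> j" "\<pi> x \<in> A"
          by blast
        then have "A \<in> (\<Union>j\<le>k. \<U> j)" by blast
        then have "\<nu> A x \<in> \<Union> (\<Union>j\<le>n. \<V> j)"
          using dec[OF _ x A(3)] by (simp only: V)
        then obtain l V where V: "l \<le> n" "V \<in> \<V> l" "\<nu> A x \<in> V"
          by blast
        \<comment> \<open>Inverse of the colour encoding; \<open>l \<le> n\<close> makes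
          \<open>l\<close> the remainder.\<close>
        define m where "m = j * (n + 1) + l"
        have "m div (n + 1) = j" "m mod (n + 1) = l"
          using V(1) by (simp_all add: m_def div_mult_self3 del: mult_Suc_right add_Suc_right)
        then have "W A V \<in> \<W> m" unfolding \<W>_def using A V by blast
        moreover have "x \<in> W A V" unfolding W_def using x A V by blast
        moreover have "m \<le> ?d"
        proof -
          have "j * (n + 1) \<le> k * (n + 1)" using A(1) by (rule mult_le_mono1)
          then show ?thesis using V(1) by (simp add: m_def algebra_simps)
        qed
        ultimately show "x \<in> \<Union> (\<Union>m\<le>?d. \<W> m)" by blast
      qed
    qed
    moreover have "S = S'"
      if m: "m \<le> ?d" and S: "S \<in> \<W> m" "S' \<in> \<W> m" "x \<in> S" "y \<in> S'"
        and xy: "inv\<^bsub>G\<^esub> x \<otimes>\<^bsub>G\<^esub> y \<in> K" for m S S' x y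
    proof -
      obtain A V A' V' where A: "A \<in> \<U> (m div (n + 1))" "A' \<in> \<U> (m div (n + 1))"
        and V: "V \<in> \<V> (m mod (n + 1))" "V' \<in> \<V> (m mod (n + 1))"
        and S_eq: "S = W A V" "S' = W A' V'"
        using S(1,2) unfolding \<W>_def by blast
      have x: "x \<in> carrier G" "\<pi> x \<in> A" "\<nu> A x \<in> V" and y: "y \<in> carrier G" "\<pi> y \<in> A'" "\<nu> A' y \<in> V'"
        using S(3,4) unfolding S_eq W_def by auto
      have "inv\<^bsub>Q\<^esub> (\<pi> x) \<otimes>\<^bsub>Q\<^esub> \<pi> y = \<pi> (inv\<^bsub>G\<^esub> x \<otimes>\<^bsub>G\<^esub> y)"
        using x y by simp
      \<comment> \<open>The cover of \<open>Q\<close> was chosen at the scale of the image of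
        \<open>K\<close>, so the sets below \<open>x\<close> and \<open>y\<close> agree.\<close>
      then have "A = A'"
        using U_disj[OF div[OF m] A x(2) y(2)] xy by (metis imageI)
      \<comment> \<open>Only now are the coordinates of \<open>x\<close> and \<open>y\<close> taken
        with respect to the same \<open>A\<close>, as \<open>V_eq\<close> requires.\<close>
      moreover have "V = V'"
        using V_eq[of A x y "m mod (n + 1)" V V'] A(1) div[OF m] x y xy mod V \<open>A = A'\<close> by blast
      ultimately show ?thesis using S_eq by simp
    qed
    moreover have "inv\<^bsub>G\<^esub> x \<otimes>\<^bsub>G\<^esub> y \<in> D"
      if m: "m \<le> ?d" and S: "S \<in> \<W> m" "x \<in> S" "y \<in> S" for m S x y
    proof -
      obtain A V where A: "A \<in> \<U> (m div (n + 1))" and V: "V \<in> \<V> (m mod (n + 1))"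
        and S_eq: "S = W A V"
        using S(1) unfolding \<W>_def by blast
      have x: "x \<in> carrier G" "\<pi> x \<in> A" "\<nu> A x \<in> V" and y: "y \<in> carrier G" "\<pi> y \<in> A" "\<nu> A y \<in> V"
        using S(2,3) unfolding S_eq W_def by auto
      have A': "A \<in> (\<Union>j\<le>k. \<U> j)" using A div[OF m] by blast
      have "inv\<^bsub>N\<^esub> (\<nu> A x) \<otimes>\<^bsub>N\<^esub> \<nu> A y \<in> C"
        using V_bdd[OF mod V x(3) y(3)] .
      moreover have "\<beta> A x \<in> B" "\<beta> A y \<in> B"
        using dec[OF A' x(1,2)] dec[OF A' y(1,2)] by auto
      ultimately show ?thesis
        unfolding diff[OF A' x(1,2) y(1,2)] D_def set_mult_def by blast
    qed
    ultimately show "\<exists>\<W> D. compactin TG D \<and> \<Union> (\<Union>m\<le>?d. \<W> m) = carrier G \<and>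
        (\<forall>m\<le>?d. \<forall>S\<in>\<W> m. \<forall>S'\<in>\<W> m. \<forall>x\<in>S. \<forall>y\<in>S'. inv\<^bsub>G\<^esub> x \<otimes>\<^bsub>G\<^esub> y \<in> K \<longrightarrow> S = S') \<and>
        (\<forall>m\<le>?d. \<forall>S\<in>\<W> m. \<forall>x\<in>S. \<forall>y\<in>S. inv\<^bsub>G\<^esub> x \<otimes>\<^bsub>G\<^esub> y \<in> D)"
      by (intro exI[of _ \<W>] exI[of _ D] conjI) blast+
  qed
  then show ?thesis
    by (simp add: group_asdim_def asdim_le_iff)
qed

end
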